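(* Let $A$, the iterates $u_k$, the matrices $J_k$ and the errors $e_k$ be as in the context, and let $S_k=J_{k+1}^{1/2}-J_k^{1/2}$. Then there exist a positive number $\delta$ and a constant $c_3$ such that if $\|e_k\|<\delta$ then $$\|S_k\|\le c_3\sqrt{\|e_k\|}.$$
   Context: $A\in\mathbb{R}^{n\times n}$ is symmetric positive definite with eigenvalues $\lambda_1<\lambda_2<\dots<\lambda_n$ and unit eigenvector $v_1$ for $\lambda_1$. Vector norms are Euclidean and the norm of a symmetric matrix is the spectral norm. Newton iteration: $u_0$ is a unit vector; for $k\ge 0$, $\theta_k=u_k^\top A u_k$, $$J_k=(I-u_ku_k^\top)(A-\theta_k I)(I-u_ku_k^\top),$$ $s_k$ is an (exact or approximate) solution, lying in the subspace orthogonal to $u_k$, of the correction equation $J_ks_k=-(Au_k-\theta_ku_k)$, and $u_{k+1}=(u_k+s_k)/\|u_k+s_k\|$. Set $e_k=u_k-v_1$. Standing assumption: convergence holds, i.e. there is a constant $r<1$ with $\|e_{k+1}\|<r\|e_k\|$ for all $k\ge0$. For $u_k$ sufficiently close to $v_1$, $J_k$ is positive semidefinite (positive definite on $u_k^\perp$, with $J_ku_k=0$), and $J_k^{1/2}$ denotes its positive semidefinite square root. The numbers $\delta$ and $c_3$ do not depend on $k$. *)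

theory Defs
  imports "HOL-Analysis.Analysis"
begin

definition symmetric_mat :: "real^'n^'n \<Rightarrow> bool" where
  "symmetric_mat M \<longleftrightarrow> transpose M = M"

definition pos_def_mat :: "real^'n^'n \<Rightarrow> bool" where
  "pos_def_mat M \<longleftrightarrow> symmetric_mat M \<and> (\<forall>x. x \<noteq> 0 \<longrightarrow> 0 < x \<bullet> (M *v x))"

definition pos_semidef_mat :: "real^'n^'n \<Rightarrow> bool" where
  "pos_semidef_mat M \<longleftrightarrow> symmetric_mat M \<and> (\<forall>x. 0 \<le> x \<bullet> (M *v x))"

text \<open>The positive semidefinite square root. It is meaningful only for positive semidefinite
  arguments, for which it exists and is unique; otherwise the value is unspecified.\<close>

definition mat_sqrt :: "real^'n^'n \<Rightarrow> real^'n^'n" where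
  "mat_sqrt M = (THE R. pos_semidef_mat R \<and> R ** R = M)"

text \<open>The spectral norm, as the operator norm induced by the Euclidean norm
  (the \<open>norm\<close> of the type is the Frobenius norm).\<close>

definition spectral_norm :: "real^'n^'n \<Rightarrow> real" where
  "spectral_norm M = onorm (\<lambda>x. M *v x)"

definition eigenvalues :: "real^'n^'n \<Rightarrow> real set" where
  "eigenvalues M = {\<mu>. \<exists>v. v \<noteq> 0 \<and> M *v v = \<mu> *\<^sub>R v}"

text \<open>For distinct \<open>lam 1, \<dots>, lam n\<close> with \<open>n\<close> the dimension, equality of the sets
  also forces every eigenvalue to be simple.\<close>

definition ordered_eigenvalues :: "real^'n^'n \<Rightarrow> (nat \<Rightarrow> real) \<Rightarrow> bool" where
  "ordered_eigenvalues M lam \<longleftrightarrow>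
     strict_mono_on {1..CARD('n)} lam \<and> eigenvalues M = lam ` {1..CARD('n)}"

definition rayleigh :: "real^'n^'n \<Rightarrow> real^'n \<Rightarrow> real" where
  "rayleigh A u = u \<bullet> (A *v u)"

definition newton_mat :: "real^'n^'n \<Rightarrow> real^'n \<Rightarrow> real^'n^'n" where
  "newton_mat A u =
     (let P = mat 1 - (\<chi> i j. u $ i * u $ j)
      in P ** (A - rayleigh A u *\<^sub>R mat 1) ** P)"

text \<open>The vector \<open>\<rho> k\<close> is the residual with which \<open>s k\<close> solves the correction equation:
  \<open>\<rho> k = 0\<close> is an exact solve, an arbitrary \<open>\<rho> k\<close> an approximate one. No accuracy is
  prescribed for the approximate solve. Since \<open>s k\<close> is orthogonal to the unit
  vector \<open>u k\<close>, the normalisation never divides by zero.\<close>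

definition newton_iteration ::
    "real^'n^'n \<Rightarrow> (nat \<Rightarrow> real^'n) \<Rightarrow> (nat \<Rightarrow> real^'n) \<Rightarrow> (nat \<Rightarrow> real^'n) \<Rightarrow> bool" where
  "newton_iteration A u s \<rho> \<longleftrightarrow>
     norm (u 0) = 1 \<and>
     (\<forall>k. u k \<bullet> s k = 0 \<and>
          newton_mat A (u k) *v s k = - (A *v u k - rayleigh A (u k) *\<^sub>R u k) + \<rho> k \<and>
          u (Suc k) = (u k + s k) /\<^sub>R norm (u k + s k))"

end

theory Submission
  imports Defs
begin

text \<open>
  The positive semidefinite square root is 1/2-Hoelder: if \<open>R\<close> and \<open>T\<close> are positive semidefinite
  and \<open>v\<close> is a unit eigenvector of \<open>R - T\<close> whose eigenvalue \<open>\<mu>\<close> has modulus \<open>\<parallel>R - T\<parallel>\<close>, then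
  \<open>v \<bullet> (R\<^sup>2 - T\<^sup>2) v = \<mu> (v \<bullet> R v + v \<bullet> T v)\<close>, which in modulus is at least
  \<open>\<bar>\<mu>\<bar> \<bar>v \<bullet> R v - v \<bullet> T v\<bar> = \<mu>\<^sup>2\<close>; hence \<open>\<parallel>R - T\<parallel>\<^sup>2 \<le> \<parallel>R\<^sup>2 - T\<^sup>2\<parallel>\<close>. The Newton matrix is
  Lipschitz in the unit vector \<open>u\<close>, so \<open>\<parallel>J\<^sub>k\<^sub>+\<^sub>1 - J\<^sub>k\<parallel>\<close> is of order \<open>\<parallel>e\<^sub>k\<parallel>\<close>; and it is positive
  semidefinite near \<open>v\<^sub>1\<close> because the quadratic form of \<open>A\<close> is bounded below by some \<open>g > \<lambda>\<^sub>1\<close> on the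
  orthogonal complement of \<open>v\<^sub>1\<close>, while the Rayleigh quotient tends to \<open>\<lambda>\<^sub>1\<close>.
\<close>

section \<open>Spectral theory of self-adjoint operators\<close>

lemma self_adjoint_top_eigenvector:
  fixes f :: "'a::euclidean_space \<Rightarrow> 'a"
  assumes lin: "linear f" and adj: "\<And>x y. x \<bullet> f y = f x \<bullet> y"
    and S: "subspace S" "\<And>x. x \<in> S \<Longrightarrow> f x \<in> S" "S \<noteq> {0}"
  obtains v \<mu> where "v \<in> S" "norm v = 1" "f v = \<mu> *\<^sub>R v"
    "\<And>y. y \<in> S \<Longrightarrow> y \<bullet> f y \<le> \<mu> * (norm y)\<^sup>2"
proof -
  interpret linear f by (fact lin)
  let ?C = "S \<inter> sphere 0 1"
  obtain w where w: "w \<in> S" "w \<noteq> 0"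
    using S subspace_0 by blast
  have "w /\<^sub>R norm w \<in> ?C"
    using w S(1) by (simp add: subspace_scale)
  moreover have "compact ?C"
    using closed_subspace[OF S(1)] by (simp add: closed_Int_compact)
  moreover have "continuous_on ?C (\<lambda>x. x \<bullet> f x)"
    by (intro continuous_intros linear_continuous_on) (simp add: lin linear_conv_bounded_linear[symmetric])
  ultimately obtain v where v: "v \<in> ?C" and max: "\<And>y. y \<in> ?C \<Longrightarrow> y \<bullet> f y \<le> v \<bullet> f v"
    using continuous_attains_sup[of ?C "\<lambda>x. x \<bullet> f x"] by blast
  define \<mu> where "\<mu> = v \<bullet> f v"
  have nv: "norm v = 1" "v \<in> S" using v by auto
  have bound: "y \<bullet> f y \<le> \<mu> * (norm y)\<^sup>2" if "y \<in> S" for y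
  proof (cases "y = 0")
    case False
    have "y /\<^sub>R norm y \<in> ?C"
      using that False S(1) by (simp add: subspace_scale)
    from max[OF this] False show ?thesis
      by (simp add: \<mu>_def scale field_simps power2_eq_square)
  qed (simp add: zero)
  define w where "w = \<mu> *\<^sub>R v - f v"
  have wS: "w \<in> S"
    unfolding w_def using nv S by (intro subspace_diff subspace_scale) auto
  \<comment> \<open>The form \<open>\<mu> |x|\<^sup>2 - x \<bullet> f x\<close> is nonnegative on \<open>S\<close> and vanishes at \<open>v\<close>, so its
     gradient \<open>2 w\<close> at \<open>v\<close> vanishes.\<close>
  have "w = 0"
  proof (rule ccontr)
    assume "w \<noteq> 0"
    define q where "q = \<mu> * (w \<bullet> w) - w \<bullet> f w"
    have q: "0 \<le> q" using bound[OF wS] by (simp add: q_def power2_norm_eq_inner)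
    have ineq: "0 \<le> 2 * t * (w \<bullet> w) + t\<^sup>2 * q" for t
    proof -
      have "v + t *\<^sub>R w \<in> S"
        using nv wS S(1) by (intro subspace_add subspace_scale) auto
      from bound[OF this]
      have "0 \<le> \<mu> * ((v + t *\<^sub>R w) \<bullet> (v + t *\<^sub>R w)) - (v + t *\<^sub>R w) \<bullet> f (v + t *\<^sub>R w)"
        by (simp add: power2_norm_eq_inner)
      also have "\<dots> = \<mu> * (v \<bullet> v) - v \<bullet> f v + 2 * t * (\<mu> * (v \<bullet> w) - f v \<bullet> w) + t\<^sup>2 * q"
        using adj[of v w]
        by (simp add: add scale inner_add_left inner_add_right q_def power2_eq_square
            inner_commute[of w v] inner_commute[of w "f v"] algebra_simps)
      also have "\<mu> * (v \<bullet> v) - v \<bullet> f v = 0"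
        using nv by (simp add: \<mu>_def dot_square_norm)
      also have "\<mu> * (v \<bullet> w) - f v \<bullet> w = w \<bullet> w"
        by (simp add: w_def inner_diff_left)
      finally show ?thesis by simp
    qed
    have ww: "0 < w \<bullet> w" using \<open>w \<noteq> 0\<close> by simp
    define t where "t = - (w \<bullet> w) / (q + 1)"
    have t: "t < 0" using ww q by (simp add: t_def divide_neg_pos)
    have "2 * t * (w \<bullet> w) + t\<^sup>2 * q = t * (2 * (w \<bullet> w) + t * q)"
      by (simp add: algebra_simps power2_eq_square)
    moreover have "t * q \<ge> - (w \<bullet> w)"
    proof -
      have "(w \<bullet> w) * (q / (q + 1)) \<le> (w \<bullet> w) * 1"
        using q ww by (intro mult_left_mono) auto
      then show ?thesis by (simp add: t_def)
    qed
    then have "2 * (w \<bullet> w) + t * q > 0" using ww by linarith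
    ultimately have "2 * t * (w \<bullet> w) + t\<^sup>2 * q < 0"
      using t by (simp add: mult_neg_pos)
    with ineq[of t] show False by linarith
  qed
  then have "f v = \<mu> *\<^sub>R v" by (simp add: w_def)
  with nv bound that show thesis by blast
qed

lemma self_adjoint_orthonormal_eigenbasis:
  fixes f :: "'a::euclidean_space \<Rightarrow> 'a"
  assumes lin: "linear f" and adj: "\<And>x y. x \<bullet> f y = f x \<bullet> y"
  obtains B where "finite B" "pairwise orthogonal B" "\<And>b. b \<in> B \<Longrightarrow> norm b = 1"
    "\<And>b. b \<in> B \<Longrightarrow> f b = (b \<bullet> f b) *\<^sub>R b" "span B = UNIV"
proof -
  define P where "P B \<longleftrightarrow> finite B \<and> pairwise orthogonal B
      \<and> (\<forall>b\<in>B. norm b = 1 \<and> f b = (b \<bullet> f b) *\<^sub>R b)" for B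
  have "card B \<le> DIM('a)" if "P B" for B
  proof -
    have "independent B"
      using that by (intro pairwise_orthogonal_independent) (auto simp: P_def)
    then show ?thesis using independent_bound by blast
  qed
  moreover have "P {}" by (simp add: P_def)
  ultimately have "\<exists>B. P B \<and> (\<forall>B'. P B' \<longrightarrow> card B' \<le> card B)"
    by (intro ex_has_greatest_nat[of P "{}" card "Suc DIM('a)"]) (auto simp: less_Suc_eq_le)
  then obtain B where B: "P B" and greatest: "\<And>B'. P B' \<Longrightarrow> card B' \<le> card B"
    by blast
  define S where "S = {y. \<forall>b\<in>B. orthogonal b y}"
  have sub: "subspace S"
    unfolding S_def by (rule subspace_orthogonal_to_vectors)
  have inv: "f x \<in> S" if "x \<in> S" for x
    unfolding S_def
  proof safe
    fix b assume b: "b \<in> B"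
    then have "f b = (b \<bullet> f b) *\<^sub>R b" using B by (simp add: P_def)
    then have "b \<bullet> f x = (b \<bullet> f b) * (b \<bullet> x)"
      by (metis adj inner_scaleR_left)
    then show "orthogonal b (f x)" using that b by (simp add: S_def orthogonal_def)
  qed
  have "S = {0}"
  proof (rule ccontr)
    assume "S \<noteq> {0}"
    then obtain v \<mu> where v: "v \<in> S" "norm v = 1" "f v = \<mu> *\<^sub>R v"
      using self_adjoint_top_eigenvector[OF lin adj sub inv] by metis
    have "v \<notin> B" using v by (auto simp: S_def orthogonal_self)
    moreover have "P (insert v B)"
      using B v by (auto simp: P_def pairwise_insert S_def orthogonal_commute dot_square_norm)
    ultimately show False
      using greatest[of "insert v B"] B by (simp add: P_def)
  qed
  moreover have "x - (\<Sum>b\<in>B. (x \<bullet> b) *\<^sub>R b) \<in> S" for x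
    unfolding S_def
  proof safe
    fix b assume b: "b \<in> B"
    have "(\<Sum>c\<in>B. (x \<bullet> c) * (b \<bullet> c)) = (\<Sum>c\<in>B. if c = b then x \<bullet> b else 0)"
      using B b by (intro sum.cong) (auto simp: P_def pairwise_def orthogonal_def dot_square_norm)
    then show "orthogonal b (x - (\<Sum>b\<in>B. (x \<bullet> b) *\<^sub>R b))"
      using B b by (simp add: orthogonal_def inner_diff_right inner_sum_right P_def inner_commute)
  qed
  ultimately have "x = (\<Sum>b\<in>B. (x \<bullet> b) *\<^sub>R b)" for x by force
  then have "x \<in> span B" for x
    by (metis (no_types, lifting) span_base span_scale span_sum)
  then have "span B = UNIV" by auto
  with B that show thesis unfolding P_def by blast
qed

lemma self_adjoint_norming_eigenvector:
  fixes f :: "'a::euclidean_space \<Rightarrow> 'a"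
  assumes lin: "linear f" and adj: "\<And>x y. x \<bullet> f y = f x \<bullet> y"
  obtains v \<mu> where "norm v = 1" "f v = \<mu> *\<^sub>R v" "\<bar>\<mu>\<bar> = onorm f"
proof -
  interpret linear f by (fact lin)
  have bl: "bounded_linear f" by (simp add: lin linear_conv_bounded_linear[symmetric])
  have "linear (f \<circ> f)" using lin by (rule linear_compose[OF lin])
  moreover have "x \<bullet> (f \<circ> f) y = (f \<circ> f) x \<bullet> y" for x y by (simp add: adj)
  moreover have "(UNIV :: 'a set) \<noteq> {0}"
    using UNIV_not_singleton by blast
  ultimately obtain v m where v: "norm v = 1" "f (f v) = m *\<^sub>R v"
    and m: "\<And>y. y \<bullet> f (f y) \<le> m * (norm y)\<^sup>2"
    using self_adjoint_top_eigenvector[of "f \<circ> f" UNIV] by (metis UNIV_I comp_apply subspace_UNIV)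
  have m0: "m = (norm (f v))\<^sup>2"
    using v adj[of v "f v"] by (simp add: dot_square_norm)
  define s where "s = norm (f v)"
  have "norm (f y) \<le> s * norm y" for y
  proof (rule power2_le_imp_le)
    show "(norm (f y))\<^sup>2 \<le> (s * norm y)\<^sup>2"
      using m[of y] adj[of y "f y"] by (simp add: power_mult_distrib m0 s_def dot_square_norm)
  qed (simp add: s_def)
  then have "onorm f \<le> s" by (rule onorm_le)
  moreover have "s \<le> onorm f" using onorm[OF bl, of v] v by (simp add: s_def)
  ultimately have s: "s = onorm f" by simp
  have ffv: "f (f v) = (s * s) *\<^sub>R v" using v m0 by (simp add: s_def power2_eq_square)
  show thesis
  proof (cases "f v + s *\<^sub>R v = 0")
    case True
    then have "f v = (- s) *\<^sub>R v" by (simp add: eq_neg_iff_add_eq_0)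
    moreover have "\<bar>- s\<bar> = onorm f" unfolding s[symmetric] by (simp add: s_def)
    ultimately show thesis by (rule that[OF v(1)])
  next
    case False
    define w where "w = f v + s *\<^sub>R v"
    have fw: "f w = s *\<^sub>R w"
      by (simp add: w_def add scale ffv algebra_simps)
    show thesis
    proof (rule that[of "w /\<^sub>R norm w" s])
      show "norm (w /\<^sub>R norm w) = 1" using False by (simp add: w_def)
      show "f (w /\<^sub>R norm w) = s *\<^sub>R (w /\<^sub>R norm w)" by (simp add: scale fw)
      show "\<bar>s\<bar> = onorm f" unfolding s[symmetric] by (simp add: s_def)
    qed
  qed
qed

section \<open>Positive semidefinite square roots\<close>

lemma symmetric_mat_iff:
  fixes M :: "real^'n^'n"
  shows "symmetric_mat M \<longleftrightarrow> (\<forall>x y. x \<bullet> (M *v y) = (M *v x) \<bullet> y)"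
proof
  assume "symmetric_mat M"
  then show "\<forall>x y. x \<bullet> (M *v y) = (M *v x) \<bullet> y"
    unfolding symmetric_mat_def by (metis dot_lmul_matrix vector_transpose_matrix)
next
  assume r: "\<forall>x y. x \<bullet> (M *v y) = (M *v x) \<bullet> y"
  have "x \<bullet> (transpose M *v y) = x \<bullet> (M *v y)" for x y
    using r by (metis dot_lmul_matrix inner_commute transpose_matrix_vector)
  then have "transpose M *v y = M *v y" for y
    by (metis vector_eq_rdot inner_commute)
  then show "symmetric_mat M"
    unfolding symmetric_mat_def by (simp add: matrix_eq)
qed

lemma pos_semidef_mat_root_exists:
  fixes M :: "real^'n^'n"
  assumes "pos_semidef_mat M"
  obtains R where "pos_semidef_mat R" "R ** R = M"
proof -
  have adj: "\<And>x y. x \<bullet> (M *v y) = (M *v x) \<bullet> y" and pos: "\<And>x. 0 \<le> x \<bullet> (M *v x)"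
    using assms by (auto simp: pos_semidef_mat_def symmetric_mat_iff)
  obtain B where B: "finite B" "pairwise orthogonal B" "\<And>b. b \<in> B \<Longrightarrow> norm b = 1"
    "\<And>b. b \<in> B \<Longrightarrow> M *v b = (b \<bullet> (M *v b)) *\<^sub>R b" "span B = UNIV"
    using self_adjoint_orthonormal_eigenbasis[OF matrix_vector_mul_linear adj] by metis
  define \<sigma> where "\<sigma> b = sqrt (b \<bullet> (M *v b))" for b
  have \<sigma>: "0 \<le> \<sigma> b" "\<sigma> b * \<sigma> b = b \<bullet> (M *v b)" for b
    using pos by (simp_all add: \<sigma>_def)
  define h where "h x = (\<Sum>b\<in>B. (\<sigma> b * (b \<bullet> x)) *\<^sub>R b)" for x
  have lin: "linear h"
    by (rule linearI) (simp_all add: h_def algebra_simps inner_add_right sum.distrib scaleR_sum_right)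
  have expand: "x = (\<Sum>b\<in>B. (b \<bullet> x) *\<^sub>R b)" for x
    using orthonormal_basis_expand[OF B(2,3) _ B(1), of x] B(5) by (simp add: inner_commute)
  have hb: "h b = \<sigma> b *\<^sub>R b" if "b \<in> B" for b
  proof -
    have "h b = (\<Sum>c\<in>B. if c = b then \<sigma> b *\<^sub>R b else 0)"
      unfolding h_def using that B(2,3)
      by (intro sum.cong) (auto simp: pairwise_def orthogonal_def dot_square_norm)
    with that B(1) show ?thesis by simp
  qed
  define R where "R = matrix h"
  have R: "R *v x = h x" for x by (simp add: R_def matrix_works lin)
  have hinner: "x \<bullet> h y = (\<Sum>b\<in>B. \<sigma> b * (b \<bullet> x) * (b \<bullet> y))" for x y
    unfolding h_def by (simp add: inner_sum_right inner_commute algebra_simps)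
  have "x \<bullet> h y = h x \<bullet> y" for x y
    using hinner[of x y] hinner[of y x] by (simp add: inner_commute[of "h x"] algebra_simps)
  moreover have "0 \<le> x \<bullet> h x" for x
    unfolding hinner using \<sigma>(1) by (intro sum_nonneg) (simp add: mult.assoc)
  ultimately have "pos_semidef_mat R"
    by (simp add: pos_semidef_mat_def symmetric_mat_iff R)
  moreover have "R ** R = M"
  proof -
    have hhb: "h (h b) = M *v b" if "b \<in> B" for b
      using that B(4)[OF that] \<sigma>(2)[of b] by (simp add: hb linear_scale[OF lin])
    have "h (h x) = M *v x" for x
    proof -
      have "h (h x) = h (h (\<Sum>b\<in>B. (b \<bullet> x) *\<^sub>R b))" using expand[of x] by simp
      also have "\<dots> = (\<Sum>b\<in>B. (b \<bullet> x) *\<^sub>R h (h b))"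
        by (simp add: linear_sum[OF lin] linear_scale[OF lin])
      also have "\<dots> = (\<Sum>b\<in>B. (b \<bullet> x) *\<^sub>R (M *v b))"
        by (simp add: hhb)
      also have "\<dots> = M *v (\<Sum>b\<in>B. (b \<bullet> x) *\<^sub>R b)"
        by (simp add: linear_sum[OF matrix_vector_mul_linear] linear_scale[OF matrix_vector_mul_linear])
      finally show ?thesis using expand[of x] by simp
    qed
    then show ?thesis by (simp add: matrix_eq R flip: matrix_vector_mul_assoc)
  qed
  ultimately show thesis by (rule that)
qed

lemma matrix_vector_mult_le_spectral_norm: "norm (M *v x) \<le> spectral_norm M * norm x"
  unfolding spectral_norm_def by (rule onorm) simp

lemma spectral_norm_root_diff_le:
  fixes R T :: "real^'n^'n"
  assumes "pos_semidef_mat R" "pos_semidef_mat T"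
  shows "(spectral_norm (R - T))\<^sup>2 \<le> spectral_norm (R ** R - T ** T)"
proof -
  have R: "\<And>x y. x \<bullet> (R *v y) = (R *v x) \<bullet> y" "\<And>x. 0 \<le> x \<bullet> (R *v x)"
    and T: "\<And>x y. x \<bullet> (T *v y) = (T *v x) \<bullet> y" "\<And>x. 0 \<le> x \<bullet> (T *v x)"
    using assms by (auto simp: pos_semidef_mat_def symmetric_mat_iff)
  have D: "\<And>x y. x \<bullet> ((R - T) *v y) = ((R - T) *v x) \<bullet> y"
    by (simp add: matrix_vector_mult_diff_rdistrib inner_diff_left inner_diff_right R T)
  obtain v \<mu> where v: "norm v = 1" "(R - T) *v v = \<mu> *\<^sub>R v" "\<bar>\<mu>\<bar> = spectral_norm (R - T)"
    using self_adjoint_norming_eigenvector[OF matrix_vector_mul_linear D]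
    unfolding spectral_norm_def by metis
  define a b where "a = v \<bullet> (R *v v)" and "b = v \<bullet> (T *v v)"
  have ab: "0 \<le> a" "0 \<le> b" unfolding a_def b_def by (rule R(2) T(2))+
  have diff: "R *v v - T *v v = \<mu> *\<^sub>R v" using v by (simp add: matrix_vector_mult_diff_rdistrib)
  have \<mu>: "\<mu> = a - b"
    using arg_cong[OF diff, of "inner v"] v by (simp add: inner_diff_right a_def b_def dot_square_norm)
  \<comment> \<open>\<open>R\<^sup>2 - T\<^sup>2 = R (R - T) + (R - T) T\<close>\<close>
  have "v \<bullet> ((R ** R - T ** T) *v v) = (R *v v) \<bullet> (R *v v) - (T *v v) \<bullet> (T *v v)"
    by (simp add: matrix_vector_mult_diff_rdistrib inner_diff_right R(1) T(1) flip: matrix_vector_mul_assoc)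
  also have "\<dots> = (R *v v) \<bullet> (R *v v - T *v v) + (R *v v - T *v v) \<bullet> (T *v v)"
    by (simp add: inner_diff_left inner_diff_right)
  also have "\<dots> = \<mu> * (a + b)"
    unfolding diff by (simp add: a_def b_def inner_commute algebra_simps)
  finally have eq: "v \<bullet> ((R ** R - T ** T) *v v) = \<mu> * (a + b)" .
  have "(spectral_norm (R - T))\<^sup>2 = \<bar>\<mu>\<bar> * \<bar>\<mu>\<bar>" by (simp add: v(3)[symmetric] power2_eq_square)
  also have "\<dots> \<le> \<bar>\<mu>\<bar> * (a + b)" using ab \<mu> by (intro mult_left_mono) auto
  also have "\<dots> = \<bar>v \<bullet> ((R ** R - T ** T) *v v)\<bar>" using ab by (simp add: eq abs_mult)
  also have "\<dots> \<le> norm v * norm ((R ** R - T ** T) *v v)" by (rule Cauchy_Schwarz_ineq2)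
  also have "\<dots> \<le> spectral_norm (R ** R - T ** T)"
    using matrix_vector_mult_le_spectral_norm[of "R ** R - T ** T" v] v by simp
  finally show ?thesis .
qed

lemma spectral_norm_0 [simp]: "spectral_norm 0 = 0"
  by (simp add: spectral_norm_def onorm_zero)

lemma pos_semidef_mat_root_unique:
  assumes "pos_semidef_mat R" "pos_semidef_mat T" "R ** R = T ** T"
  shows "R = T"
proof -
  have "spectral_norm (R - T) = 0"
    using spectral_norm_root_diff_le[OF assms(1,2)] assms(3) by simp
  then have "(R - T) *v x = 0" for x
    using matrix_vector_mult_le_spectral_norm[of "R - T" x] by simp
  then show ?thesis by (simp add: matrix_eq matrix_vector_mult_diff_rdistrib)
qed

lemma mat_sqrt:
  assumes "pos_semidef_mat M"
  shows pos_semidef_mat_sqrt: "pos_semidef_mat (mat_sqrt M)"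
    and mat_sqrt_square: "mat_sqrt M ** mat_sqrt M = M"
proof -
  obtain R where R: "pos_semidef_mat R" "R ** R = M"
    using pos_semidef_mat_root_exists[OF assms] by blast
  have "T = R" if "pos_semidef_mat T \<and> T ** T = M" for T
    using pos_semidef_mat_root_unique[of T R] that R by simp
  with R have "mat_sqrt M = R"
    unfolding mat_sqrt_def by (intro the_equality conjI)
  with R show "pos_semidef_mat (mat_sqrt M)" "mat_sqrt M ** mat_sqrt M = M" by auto
qed

lemma spectral_norm_mat_sqrt_diff_le:
  assumes "pos_semidef_mat X" "pos_semidef_mat Y"
  shows "spectral_norm (mat_sqrt X - mat_sqrt Y) \<le> sqrt (spectral_norm (X - Y))"
  using spectral_norm_root_diff_le[OF assms[THEN pos_semidef_mat_sqrt]]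
  by (simp add: mat_sqrt_square assms real_le_rsqrt)

section \<open>The Newton matrix near the lowest eigenvector\<close>

lemma ordered_eigenvalues_gap:
  fixes A :: "real^'n^'n"
  assumes "symmetric_mat A" "ordered_eigenvalues A lam"
    and v: "norm v = 1" "A *v v = lam 1 *\<^sub>R v"
  obtains g where "lam 1 < g" "\<And>y. v \<bullet> y = 0 \<Longrightarrow> g * (norm y)\<^sup>2 \<le> y \<bullet> (A *v y)"
proof (cases "{y. orthogonal v y} = {0}")
  case True
  then have "y = 0" if "v \<bullet> y = 0" for y
    using that by (auto simp: orthogonal_def)
  then show thesis using that[of "lam 1 + 1"] by fastforce
next
  case False
  have adj: "\<And>x y. x \<bullet> (A *v y) = (A *v x) \<bullet> y"
    using assms(1) by (simp add: symmetric_mat_iff)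
  define f where "f x = - (A *v x)" for x
  have lin: "linear f" unfolding f_def
    by (rule linear_compose_neg) simp
  have fadj: "x \<bullet> f y = f x \<bullet> y" for x y by (simp add: f_def adj)
  have inv: "f x \<in> {y. orthogonal v y}" if "x \<in> {y. orthogonal v y}" for x
    using that adj[of v x] by (simp add: f_def orthogonal_def v)
  obtain w m where w: "orthogonal v w" "norm w = 1" "f w = m *\<^sub>R w"
    and m: "\<And>y. orthogonal v y \<Longrightarrow> y \<bullet> f y \<le> m * (norm y)\<^sup>2"
    using self_adjoint_top_eigenvector[OF lin fadj subspace_orthogonal_to_vector inv False]
    by (metis mem_Collect_eq)
  define g where "g = - m"
  have Aw: "A *v w = g *\<^sub>R w" using w(3) unfolding f_def g_def by (metis add.inverse_inverse scaleR_minus_left)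
  have bound: "g * (norm y)\<^sup>2 \<le> y \<bullet> (A *v y)" if "v \<bullet> y = 0" for y
    using m[of y] that by (simp add: f_def g_def orthogonal_def)
  let ?I = "{1..CARD('n)}"
  have lam: "strict_mono_on ?I lam" and ev: "eigenvalues A = lam ` ?I"
    using assms(2) by (auto simp: ordered_eigenvalues_def)
  have one: "1 \<in> ?I" by simp
  have "w \<noteq> 0" using w by auto
  with Aw have "g \<in> eigenvalues A" by (auto simp: eigenvalues_def)
  then obtain i where i: "i \<in> ?I" "g = lam i" using ev by auto
  have "g \<noteq> lam 1"
  \<comment> \<open>Otherwise \<open>w\<close> and one eigenvector for each of the \<open>n\<close> eigenvalues are \<open>n + 1\<close>
     orthogonal vectors.\<close>
  proof
    assume g1: "g = lam 1"
    have "\<exists>x. x \<noteq> 0 \<and> A *v x = lam j *\<^sub>R x" if "j \<in> ?I" for j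
    proof -
      have "lam j \<in> eigenvalues A" using that ev by blast
      then show ?thesis by (simp add: eigenvalues_def)
    qed
    then obtain z' where z': "\<And>j. j \<in> ?I \<Longrightarrow> z' j \<noteq> 0 \<and> A *v z' j = lam j *\<^sub>R z' j"
      by metis
    define z where "z = z'(1 := v)"
    have z: "z j \<noteq> 0" "A *v z j = lam j *\<^sub>R z j" if "j \<in> ?I" for j
      using z'[OF that] v by (auto simp: z_def)
    have inj: "inj_on lam ?I" using lam by (rule strict_mono_on_imp_inj_on)
    have orth: "x \<bullet> y = 0" if "A *v x = a *\<^sub>R x" "A *v y = b *\<^sub>R y" "a \<noteq> b" for x y a b
      using adj[of x y] that by simp
    have zz: "z j \<bullet> z k = 0" if "j \<in> ?I" "k \<in> ?I" "j \<noteq> k" for j k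
      using orth[OF z(2)[OF that(1)] z(2)[OF that(2)]] inj_onD[OF inj _ that(1,2)] that(3) by blast
    have injz: "inj_on z ?I"
    proof (rule inj_onI, rule ccontr)
      fix j k assume jk: "j \<in> ?I" "k \<in> ?I" "z j = z k" "j \<noteq> k"
      then have "z j \<bullet> z j = 0" using zz[of j k] by simp
      with z(1)[OF jk(1)] show False by simp
    qed
    have wz: "w \<bullet> z j = 0" if "j \<in> ?I" for j
    proof (cases "j = 1")
      case True
      then show ?thesis using w by (simp add: z_def orthogonal_def inner_commute)
    next
      case False
      then have "lam 1 \<noteq> lam j" using inj that one by (metis inj_onD)
      then show ?thesis using orth[OF Aw z(2)[OF that]] g1 by simp
    qed
    have "w \<notin> z ` ?I"
    proof
      assume "w \<in> z ` ?I"
      then have "w \<bullet> w = 0" using wz by blast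
      with \<open>w \<noteq> 0\<close> show False by simp
    qed
    then have "card (insert w (z ` ?I)) = Suc CARD('n)"
      using injz by (simp add: card_image)
    moreover have "pairwise orthogonal (insert w (z ` ?I))"
      unfolding pairwise_insert orthogonal_def pairwise_image
      using zz wz by (fastforce simp: pairwise_def inner_commute[of _ w])
    then have "independent (insert w (z ` ?I))"
      using \<open>w \<noteq> 0\<close> z(1) by (intro pairwise_orthogonal_independent) auto
    then have "card (insert w (z ` ?I)) \<le> DIM(real^'n)" using independent_bound by blast
    ultimately show False by simp
  qed
  then have "lam 1 < lam i"
    using i lam one by (metis atLeastAtMost_iff le_neq_implies_less strict_mono_onD)
  with i bound that show thesis by blast
qed

definition proj_perp :: "'a::real_inner \<Rightarrow> 'a \<Rightarrow> 'a" where
  "proj_perp u x = x - (u \<bullet> x) *\<^sub>R u"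

lemma proj_perp_adjoint: "x \<bullet> proj_perp u y = proj_perp u x \<bullet> y"
  by (simp add: proj_perp_def inner_diff_left inner_diff_right inner_commute)

lemma proj_perp_add: "proj_perp u (x + y) = proj_perp u x + proj_perp u y"
  by (simp add: proj_perp_def inner_add_right algebra_simps)

lemma proj_perp_diff: "proj_perp u (x - y) = proj_perp u x - proj_perp u y"
  by (simp add: proj_perp_def inner_diff_right algebra_simps)

lemma proj_perp_scaleR: "proj_perp u (c *\<^sub>R x) = c *\<^sub>R proj_perp u x"
  by (simp add: proj_perp_def algebra_simps)

lemma inner_proj_perp_self: "norm u = 1 \<Longrightarrow> u \<bullet> proj_perp u x = 0"
  by (simp add: proj_perp_def inner_diff_right dot_square_norm)

lemma norm_proj_perp_le:
  assumes "norm u = 1"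
  shows "norm (proj_perp u x) \<le> norm x"
proof (rule power2_le_imp_le)
  have "u \<bullet> u = 1" using assms by (simp add: dot_square_norm)
  then have "(norm (proj_perp u x))\<^sup>2 = (norm x)\<^sup>2 - (u \<bullet> x)\<^sup>2"
    unfolding power2_norm_eq_inner
    by (simp add: proj_perp_def inner_diff_left inner_diff_right inner_commute power2_eq_square)
  then show "(norm (proj_perp u x))\<^sup>2 \<le> (norm x)\<^sup>2" by simp
qed simp

lemma norm_proj_perp_diff_le:
  assumes "norm u = 1" "norm w = 1"
  shows "norm (proj_perp u x - proj_perp w x) \<le> 2 * norm (u - w) * norm x"
proof -
  have "proj_perp u x - proj_perp w x = - (((u - w) \<bullet> x) *\<^sub>R u + (w \<bullet> x) *\<^sub>R (u - w))"
    by (simp add: proj_perp_def inner_diff_left algebra_simps)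
  then have "norm (proj_perp u x - proj_perp w x) \<le> \<bar>(u - w) \<bullet> x\<bar> * norm u + \<bar>w \<bullet> x\<bar> * norm (u - w)"
    using norm_triangle_ineq[of "((u - w) \<bullet> x) *\<^sub>R u" "(w \<bullet> x) *\<^sub>R (u - w)"]
    by (simp only: norm_minus_cancel norm_scaleR)
  also have "\<dots> \<le> (norm (u - w) * norm x) * 1 + (1 * norm x) * norm (u - w)"
    using Cauchy_Schwarz_ineq2[of "u - w" x] Cauchy_Schwarz_ineq2[of w x] assms
    by (intro add_mono mult_mono) auto
  finally show ?thesis by (simp add: algebra_simps)
qed

lemma newton_mat_mult:
  fixes A :: "real^'n^'n"
  shows "newton_mat A u *v x
    = proj_perp u (A *v proj_perp u x - rayleigh A u *\<^sub>R proj_perp u x)"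
proof -
  have outer: "(\<chi> i j. u $ i * u $ j) *v y = (u \<bullet> y) *\<^sub>R u" for y :: "real^'n"
    by (simp add: vec_eq_iff matrix_vector_mult_def inner_vec_def sum_distrib_right
        sum_distrib_left ac_simps)
  have "(c *\<^sub>R mat 1) *v y = c *\<^sub>R y" for c and y :: "real^'n"
    by (simp flip: scaleR_matrix_vector_assoc)
  then show ?thesis
    by (simp add: newton_mat_def Let_def matrix_vector_mult_diff_rdistrib outer
        proj_perp_def flip: matrix_vector_mul_assoc)
qed

lemma abs_rayleigh_le: "\<bar>rayleigh A u\<bar> \<le> spectral_norm A * (norm u)\<^sup>2"
proof -
  have "\<bar>rayleigh A u\<bar> \<le> norm u * norm (A *v u)"
    unfolding rayleigh_def by (rule Cauchy_Schwarz_ineq2)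
  also have "\<dots> \<le> norm u * (spectral_norm A * norm u)"
    by (intro mult_left_mono matrix_vector_mult_le_spectral_norm) simp
  finally show ?thesis by (simp add: power2_eq_square ac_simps)
qed

lemma spectral_norm_nonneg: "0 \<le> spectral_norm A"
  unfolding spectral_norm_def by (rule onorm_pos_le) simp

lemma rayleigh_diff_le:
  assumes "norm u = 1" "norm w = 1"
  shows "\<bar>rayleigh A u - rayleigh A w\<bar> \<le> 2 * spectral_norm A * norm (u - w)"
proof -
  let ?K = "spectral_norm A"
  have "rayleigh A u - rayleigh A w = u \<bullet> (A *v (u - w)) + (u - w) \<bullet> (A *v w)"
    by (simp add: rayleigh_def matrix_vector_mult_diff_distrib inner_diff_left inner_diff_right)
  also have "\<bar>\<dots>\<bar> \<le> norm u * norm (A *v (u - w)) + norm (u - w) * norm (A *v w)"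
    using Cauchy_Schwarz_ineq2[of u "A *v (u - w)"] Cauchy_Schwarz_ineq2[of "u - w" "A *v w"]
    by linarith
  also have "\<dots> \<le> norm u * (?K * norm (u - w)) + norm (u - w) * (?K * norm w)"
    by (intro add_mono mult_left_mono matrix_vector_mult_le_spectral_norm) auto
  finally show ?thesis using assms by simp
qed

lemma spectral_norm_newton_mat_diff_le:
  assumes u: "norm u = 1" and w: "norm w = 1"
  shows "spectral_norm (newton_mat A u - newton_mat A w) \<le> 10 * spectral_norm A * norm (u - w)"
  unfolding spectral_norm_def[of "_ - _"]
proof (rule onorm_le)
  fix x
  define K d where "K = spectral_norm A" and "d = norm (u - w)"
  define p q where "p = proj_perp u x" and "q = proj_perp w x"
  define a b where "a = rayleigh A u" and "b = rayleigh A w"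
  have K: "0 \<le> K" by (simp add: K_def spectral_norm_nonneg)
  have d: "0 \<le> d" by (simp add: d_def)
  have p: "norm p \<le> norm x" and q: "norm q \<le> norm x"
    by (simp_all add: p_def q_def norm_proj_perp_le u w)
  have pq: "norm (p - q) \<le> 2 * d * norm x"
    by (simp add: p_def q_def d_def norm_proj_perp_diff_le u w)
  have a: "\<bar>a\<bar> \<le> K" and b: "\<bar>b\<bar> \<le> K"
    using abs_rayleigh_le[of A u] abs_rayleigh_le[of A w] by (simp_all add: a_def b_def K_def u w)
  have ab: "\<bar>b - a\<bar> \<le> 2 * K * d"
    using rayleigh_diff_le[OF w u, of A] by (simp add: a_def b_def K_def d_def norm_minus_commute)
  have shift: "norm (A *v y - c *\<^sub>R y) \<le> 2 * K * norm y" if "\<bar>c\<bar> \<le> K" for c y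
  proof -
    have "norm (A *v y - c *\<^sub>R y) \<le> norm (A *v y) + \<bar>c\<bar> * norm y"
      using norm_triangle_ineq4[of "A *v y" "c *\<^sub>R y"] by simp
    also have "\<dots> \<le> K * norm y + K * norm y"
      using that matrix_vector_mult_le_spectral_norm[of A y]
      by (intro add_mono mult_right_mono) (auto simp: K_def)
    finally show ?thesis by simp
  qed
  have "(newton_mat A u - newton_mat A w) *v x
      = proj_perp u (A *v (p - q) - a *\<^sub>R (p - q)) + (b - a) *\<^sub>R proj_perp u q
        + (proj_perp u (A *v q - b *\<^sub>R q) - proj_perp w (A *v q - b *\<^sub>R q))"
    by (simp add: matrix_vector_mult_diff_rdistrib newton_mat_mult matrix_vector_mult_diff_distrib
        proj_perp_add proj_perp_diff proj_perp_scaleR a_def[symmetric] b_def[symmetric] p_def[symmetric]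
        q_def[symmetric] algebra_simps)
  also have "norm \<dots> \<le> norm (proj_perp u (A *v (p - q) - a *\<^sub>R (p - q)))
        + norm ((b - a) *\<^sub>R proj_perp u q)
        + norm (proj_perp u (A *v q - b *\<^sub>R q) - proj_perp w (A *v q - b *\<^sub>R q))"
    by (intro norm_triangle_le add_mono norm_triangle_ineq order_refl)
  also have "\<dots> \<le> 2 * K * (2 * d * norm x) + (2 * K * d) * norm x + 2 * d * (2 * K * norm x)"
  proof (intro add_mono)
    have "norm (proj_perp u (A *v (p - q) - a *\<^sub>R (p - q))) \<le> 2 * K * norm (p - q)"
      using norm_proj_perp_le[OF u] shift[OF a] order_trans by blast
    also have "\<dots> \<le> 2 * K * (2 * d * norm x)" using pq K by (intro mult_left_mono) auto
    finally show "norm (proj_perp u (A *v (p - q) - a *\<^sub>R (p - q))) \<le> 2 * K * (2 * d * norm x)" .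
    show "norm ((b - a) *\<^sub>R proj_perp u q) \<le> (2 * K * d) * norm x"
      using norm_proj_perp_le[OF u, of q] q ab K d by (auto intro!: mult_mono)
    have "norm (proj_perp u (A *v q - b *\<^sub>R q) - proj_perp w (A *v q - b *\<^sub>R q))
        \<le> 2 * d * norm (A *v q - b *\<^sub>R q)"
      unfolding d_def by (rule norm_proj_perp_diff_le[OF u w])
    also have "\<dots> \<le> 2 * d * (2 * K * norm x)"
      using K d by (intro mult_left_mono order_trans[OF shift[OF b]] q) auto
    finally show "norm (proj_perp u (A *v q - b *\<^sub>R q) - proj_perp w (A *v q - b *\<^sub>R q))
        \<le> 2 * d * (2 * K * norm x)" .
  qed
  finally show "norm ((newton_mat A u - newton_mat A w) *v x)
      \<le> 10 * spectral_norm A * norm (u - w) * norm x"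
    by (simp add: K_def d_def algebra_simps)
qed

lemma pos_semidef_newton_mat:
  fixes A :: "real^'n^'n"
  assumes sym: "symmetric_mat A" and v: "norm v = 1" "A *v v = l *\<^sub>R v"
    and gap: "l < g" "\<And>y. v \<bullet> y = 0 \<Longrightarrow> g * (norm y)\<^sup>2 \<le> y \<bullet> (A *v y)"
    and u: "norm u = 1" and near: "(g - l + 2 * spectral_norm A) * (norm (u - v))\<^sup>2 \<le> g - l"
  shows "pos_semidef_mat (newton_mat A u)"
proof -
  define K d \<theta> where "K = spectral_norm A" and "d = norm (u - v)" and "\<theta> = rayleigh A u"
  have adj: "\<And>x y. x \<bullet> (A *v y) = (A *v x) \<bullet> y"
    using sym by (simp add: symmetric_mat_iff)
  have inner_newton: "x \<bullet> (newton_mat A u *v y)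
      = proj_perp u x \<bullet> (A *v proj_perp u y) - \<theta> * (proj_perp u x \<bullet> proj_perp u y)" for x y
    by (simp add: newton_mat_mult proj_perp_adjoint inner_diff_right \<theta>_def)
  have l: "\<bar>l\<bar> \<le> K"
    using matrix_vector_mult_le_spectral_norm[of A v] v by (simp add: K_def)
  have \<theta>: "\<theta> - l \<le> 2 * K * d\<^sup>2"
  proof -
    have "\<theta> - l * (u \<bullet> u) = (u - v) \<bullet> (A *v (u - v)) - l * ((u - v) \<bullet> (u - v))"
      using v adj[of v u]
      by (simp add: \<theta>_def rayleigh_def matrix_vector_mult_diff_distrib inner_diff_left
          inner_diff_right inner_commute algebra_simps)
    then have "\<theta> - l = rayleigh A (u - v) - l * d\<^sup>2"
      using u by (simp add: rayleigh_def d_def dot_square_norm)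
    also have "\<dots> \<le> K * d\<^sup>2 + \<bar>l\<bar> * d\<^sup>2"
      using abs_rayleigh_le[of A "u - v"] mult_right_mono[OF abs_ge_minus_self, of "d\<^sup>2" l]
      by (simp add: K_def d_def)
    also have "\<dots> \<le> K * d\<^sup>2 + K * d\<^sup>2" using l by (intro add_mono mult_right_mono) auto
    finally show ?thesis by simp
  qed
  have pos: "\<theta> * (norm y)\<^sup>2 \<le> y \<bullet> (A *v y)" if uy: "u \<bullet> y = 0" for y
  proof -
    define c where "c = v \<bullet> y"
    define z where "z = y - c *\<^sub>R v"
    have vz: "v \<bullet> z = 0" using v by (simp add: z_def c_def inner_diff_right dot_square_norm)
    have y: "y = c *\<^sub>R v + z" by (simp add: z_def)
    have vAz: "v \<bullet> (A *v z) = 0" using adj[of v z] v vz by simp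
    have "v \<bullet> v = 1" using v by (simp add: dot_square_norm)
    then have ny: "(norm y)\<^sup>2 = c\<^sup>2 + (norm z)\<^sup>2"
      unfolding power2_norm_eq_inner y using vz
      by (simp add: inner_add_left inner_add_right inner_commute power2_eq_square)
    have "y \<bullet> (A *v y) = l * c\<^sup>2 + z \<bullet> (A *v z)"
      unfolding y using vz v vAz
      by (simp add: matrix_vector_right_distrib inner_add_left inner_add_right
          matrix_vector_mult_scaleR inner_commute dot_square_norm power2_eq_square algebra_simps)
    then have "l * c\<^sup>2 + g * (norm z)\<^sup>2 \<le> y \<bullet> (A *v y)" using gap(2)[OF vz] by linarith
    then have 1: "g * (norm y)\<^sup>2 - (g - l) * c\<^sup>2 \<le> y \<bullet> (A *v y)"
      by (simp add: ny algebra_simps)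
    have "c = - ((u - v) \<bullet> y)" using uy by (simp add: c_def inner_diff_left)
    then have "\<bar>c\<bar> \<le> d * norm y" using Cauchy_Schwarz_ineq2[of "u - v" y] by (simp add: d_def)
    then have "c\<^sup>2 \<le> (d * norm y)\<^sup>2" by (metis abs_ge_zero power2_abs power_mono)
    then have "(g - l) * c\<^sup>2 \<le> (g - l) * (d\<^sup>2 * (norm y)\<^sup>2)"
      using gap(1) by (intro mult_left_mono) (auto simp: power_mult_distrib)
    with 1 have 2: "(g - (g - l) * d\<^sup>2) * (norm y)\<^sup>2 \<le> y \<bullet> (A *v y)"
      by (simp add: algebra_simps)
    have "\<theta> \<le> g - (g - l) * d\<^sup>2"
      using \<theta> near by (simp add: K_def d_def algebra_simps)
    then have "\<theta> * (norm y)\<^sup>2 \<le> (g - (g - l) * d\<^sup>2) * (norm y)\<^sup>2"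
      by (intro mult_right_mono) auto
    with 2 show ?thesis by linarith
  qed
  have "x \<bullet> (newton_mat A u *v y) = y \<bullet> (newton_mat A u *v x)" for x y
    unfolding inner_newton using adj[of "proj_perp u x" "proj_perp u y"] by (simp add: inner_commute)
  then show ?thesis
    using pos[OF inner_proj_perp_self[OF u]]
    by (auto simp: pos_semidef_mat_def symmetric_mat_iff inner_newton dot_square_norm inner_commute)
qed

lemma newton_iteration_norm:
  assumes "newton_iteration A u s \<rho>"
  shows "norm (u k) = 1"
proof (induction k)
  case 0
  show ?case using assms by (simp add: newton_iteration_def)
next
  case (Suc k)
  have "u k \<bullet> s k = 0" "u (Suc k) = (u k + s k) /\<^sub>R norm (u k + s k)"
    using assms by (auto simp: newton_iteration_def)
  moreover have "u k + s k \<noteq> 0"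
  proof
    assume "u k + s k = 0"
    then have "u k \<bullet> u k + u k \<bullet> s k = 0" by (metis inner_add_right inner_zero_right)
    with Suc \<open>u k \<bullet> s k = 0\<close> show False by simp
  qed
  ultimately show ?case by simp
qed

theorem lemma3p6:
  fixes A :: "real^'n^'n"
    and lam :: "nat \<Rightarrow> real"
    and v1 :: "real^'n"
    and u s \<rho> e :: "nat \<Rightarrow> real^'n"
    and J S :: "nat \<Rightarrow> real^'n^'n"
    and r :: real
  assumes "pos_def_mat A"
    and "ordered_eigenvalues A lam"
    and "norm v1 = 1" and "A *v v1 = lam 1 *\<^sub>R v1"
    and "newton_iteration A u s \<rho>"
    and "\<And>k. J k = newton_mat A (u k)"
    and "\<And>k. e k = u k - v1"
    and "r < 1" and "\<And>k. norm (e (Suc k)) < r * norm (e k)"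
    and "\<And>k. S k = mat_sqrt (J (Suc k)) - mat_sqrt (J k)"
  shows "\<exists>\<delta> > 0. \<exists>c3. \<forall>k. norm (e k) < \<delta> \<longrightarrow> spectral_norm (S k) \<le> c3 * sqrt (norm (e k))"
proof -
  have sym: "symmetric_mat A" using assms(1) by (simp add: pos_def_mat_def)
  obtain g where g: "lam 1 < g" "\<And>y. v1 \<bullet> y = 0 \<Longrightarrow> g * (norm y)\<^sup>2 \<le> y \<bullet> (A *v y)"
    using ordered_eigenvalues_gap[OF sym assms(2-4)] by blast
  define K where "K = spectral_norm A"
  have K: "0 \<le> K" by (simp add: K_def spectral_norm_nonneg)
  define \<delta> where "\<delta> = sqrt ((g - lam 1) / (g - lam 1 + 2 * K))"
  have \<delta>: "0 < \<delta>" using g(1) K by (simp add: \<delta>_def)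
  have unit: "norm (u k) = 1" for k by (rule newton_iteration_norm[OF assms(5)])
  have decr: "norm (e (Suc k)) \<le> norm (e k)" for k
    using assms(9)[of k] mult_right_mono[of r 1 "norm (e k)"] assms(8) by simp
  have psd: "pos_semidef_mat (J k)" if "norm (e k) < \<delta>" for k
  proof -
    have "(norm (e k))\<^sup>2 \<le> \<delta>\<^sup>2" using that by (intro power_mono) auto
    also have "\<dots> = (g - lam 1) / (g - lam 1 + 2 * K)"
      using g(1) K by (simp add: \<delta>_def)
    finally have "(g - lam 1 + 2 * K) * (norm (e k))\<^sup>2 \<le> g - lam 1"
      using g(1) K by (simp add: pos_le_divide_eq mult.commute)
    then show ?thesis
      using pos_semidef_newton_mat[OF sym assms(3,4) g unit[of k]] by (simp add: assms K_def)
  qed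
  have "spectral_norm (S k) \<le> sqrt (20 * K) * sqrt (norm (e k))" if "norm (e k) < \<delta>" for k
  proof -
    have "norm (u (Suc k) - u k) = norm (e (Suc k) - e k)" by (simp add: assms(7))
    also have "\<dots> \<le> 2 * norm (e k)"
      using norm_triangle_ineq4[of "e (Suc k)" "e k"] decr[of k] by linarith
    finally have "10 * K * norm (u (Suc k) - u k) \<le> 10 * K * (2 * norm (e k))"
      using K by (intro mult_left_mono) auto
    with spectral_norm_newton_mat_diff_le[OF unit unit, of A "Suc k" k]
    have "spectral_norm (J (Suc k) - J k) \<le> 20 * K * norm (e k)"
      by (simp add: assms(6) K_def)
    then have "sqrt (spectral_norm (J (Suc k) - J k)) \<le> sqrt (20 * K * norm (e k))" by simp
    moreover have "spectral_norm (S k) \<le> sqrt (spectral_norm (J (Suc k) - J k))"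
      unfolding assms(10) using that decr[of k]
      by (intro spectral_norm_mat_sqrt_diff_le psd) auto
    ultimately show ?thesis by (simp add: real_sqrt_mult)
  qed
  with \<delta> show ?thesis by blast
qed

end
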